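(* Let $n\ge 2$ and let $N_n$ denote the number of trees of the Moran forest $\mathscr{F}_n$. Then: (i) $\mathbb{E}[N_n] = \dfrac{n}{2}$. (ii) $\mathrm{Var}(N_n) = \dfrac{n(n-2)}{6(n-1)}$. (iii) $\displaystyle G_{N_n}(z) := \mathbb{E}\bigl[z^{N_n}\bigr] = \prod_{k=1}^{n-1}\Bigl(1+\frac{k}{n-1}(z-1)\Bigr)$.
   Context: Moran forest: for fixed $n\ge 2$, consider the Markov chain on directed graphs on $\{1,\ldots,n\}$ whose transitions are: at each time-step, choose an ordered pair of distinct vertices $(u,v)$ uniformly at random; disconnect $v$ from all of its neighbors (remove all edges incident to $v$), then add the edge $\vec{uv}$. This chain has a unique stationary distribution, whose support is the set of non-empty rooted forests (those with at least one edge) on $\{1,\ldots,n\}$. The Moran forest $\mathscr{F}_n$ is a random forest having this stationary distribution. The trees of the forest are its connected components (isolated vertices count as trees). *)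

theory Defs
  imports "HOL-Probability.Probability"
begin

text \<open>
  A directed graph on \<open>{1..n}\<close> is given by its set of edges; the pair \<open>(u, v)\<close> is the edge
  from \<open>u\<close> to \<open>v\<close>. Loops are excluded.
\<close>

definition distinct_pairs :: "nat \<Rightarrow> (nat \<times> nat) set" where
  "distinct_pairs n = {(u, v) \<in> {1..n} \<times> {1..n}. u \<noteq> v}"

definition digraphs :: "nat \<Rightarrow> (nat \<times> nat) set set" where
  "digraphs n = Pow (distinct_pairs n)"

definition moran_update :: "nat \<times> nat \<Rightarrow> (nat \<times> nat) set \<Rightarrow> (nat \<times> nat) set" where
  "moran_update = (\<lambda>(u, v) E. insert (u, v) {(a, b) \<in> E. a \<noteq> v \<and> b \<noteq> v})"

definition moran_kernel :: "nat \<Rightarrow> (nat \<times> nat) set \<Rightarrow> (nat \<times> nat) set pmf" where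
  "moran_kernel n E = map_pmf (\<lambda>p. moran_update p E) (pmf_of_set (distinct_pairs n))"

definition moran_stationary :: "nat \<Rightarrow> (nat \<times> nat) set pmf \<Rightarrow> bool" where
  "moran_stationary n P \<longleftrightarrow> set_pmf P \<subseteq> digraphs n \<and> bind_pmf P (moran_kernel n) = P"

text \<open>
  The law of the Moran forest. For \<open>n \<ge> 2\<close> the stationary distribution exists and is unique;
  for \<open>n < 2\<close> there is no pair of distinct vertices to choose, and the value is meaningless.
\<close>

definition moran_forest :: "nat \<Rightarrow> (nat \<times> nat) set pmf" where
  "moran_forest n = (THE P. moran_stationary n P)"

text \<open>
  The trees of a forest on \<open>{1..n}\<close> are the classes of the relation ``joined by an undirected
  path''; the closure is reflexive, so every isolated vertex is a class of its own.
\<close>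

definition trees :: "nat \<Rightarrow> (nat \<times> nat) set \<Rightarrow> nat set set" where
  "trees n E = {1..n} // Restr ((E \<union> E\<inverse>)\<^sup>*) {1..n}"

definition num_trees :: "nat \<Rightarrow> (nat \<times> nat) set \<Rightarrow> nat" where
  "num_trees n E = card (trees n E)"

end

theory Submission
  imports Defs
begin

text \<open>
  Run the chain for a long time and look back from the present. What is now attached to a vertex
  \<open>v\<close> is decided by the last step that drew a pair \<open>(u, v)\<close>: the edge from \<open>u\<close> to \<open>v\<close> is still
  there exactly if \<open>u\<close> has not been the second component of a pair since, that is, if the last
  arrow into \<open>u\<close> is older than the last arrow into \<open>v\<close>. So the graph is a function of the
  \<^emph>\<open>history\<close>: the list of the last arrows into the \<open>n\<close> vertices, the most recent one first. A step
  of the chain moves the redrawn vertex to the head of the history, with its new source. Histories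
  thus form a Markov chain of which the Moran chain is an image (\<open>history_graph_record_arrow\<close>).
  The uniform law on histories is stationary, because every history has the same number of
  predecessors (\<open>sum_record_arrow\<close>), and its image is therefore stationary for the Moran chain.
  There is no other stationary law: a word of pairs that enters every vertex sends all graphs to
  the same graph (\<open>moran_stationary_unique\<close>).

  Under the uniform law the vertices are in uniformly random order and their sources are
  independent and uniform. The \<open>k\<close>-th oldest vertex joins the tree of an older vertex with
  probability \<open>(k - 1) / (n - 1)\<close>, and starts a new tree otherwise. The number of trees is therefore
  a sum of independent Bernoulli variables with parameters \<open>(n - k) / (n - 1)\<close>, which gives the
  generating function as a product. It is obtained here by counting histories from the oldest arrow
  to the most recent one (\<open>sum_power_history_trees\<close>). Mean and variance are then read off from the
  first coefficients of the generating function expanded at \<open>1\<close>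
  (\<open>moments_of_product_generating_function\<close>).
\<close>

section \<open>Uniqueness of stationary laws of synchronizing random maps\<close>

lemma pmf_map_pmf_of_set:
  assumes "finite M" "M \<noteq> {}"
  shows "pmf (map_pmf f (pmf_of_set M)) s = (\<Sum>m\<in>M. of_bool (f m = s)) / card M"
proof -
  have "pmf (map_pmf f (pmf_of_set M)) s = measure (pmf_of_set M) (f -` {s})"
    by (simp add: pmf_map)
  also have "\<dots> = card (M \<inter> f -` {s}) / card M"
    using assms by (simp add: measure_pmf_of_set)
  also have "real (card (M \<inter> f -` {s})) = (\<Sum>m\<in>M. of_bool (f m = s))"
    using assms(1) by (simp add: of_bool_def sum.If_cases vimage_def Int_def)
  finally show ?thesis .
qed

lemma pmf_random_map_step:
  assumes "finite M" "M \<noteq> {}" "finite S" "set_pmf P \<subseteq> S"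
  shows "card M * pmf (bind_pmf P (\<lambda>r. map_pmf (\<lambda>m. f m r) (pmf_of_set M))) s =
    (\<Sum>m\<in>M. \<Sum>r\<in>S. of_bool (f m r = s) * pmf P r)"
proof -
  have "pmf (bind_pmf P (\<lambda>r. map_pmf (\<lambda>m. f m r) (pmf_of_set M))) s =
    (\<Sum>r\<in>S. (\<Sum>m\<in>M. of_bool (f m r = s)) / card M * pmf P r)"
    using assms
    by (simp add: pmf_bind pmf_map_pmf_of_set integral_measure_pmf_real[of S] subset_iff sum_divide_distrib)
  also have "card M * \<dots> = (\<Sum>r\<in>S. \<Sum>m\<in>M. of_bool (f m r = s) * pmf P r)"
    using assms(1,2) by (simp add: sum_distrib_left sum_distrib_right)
  finally show ?thesis by (subst sum.swap) simp
qed

text \<open>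
  One step of the chain preserves the total mass of the positive part \<open>d\<^sup>+\<close>. Where mass of opposite
  signs meets, the image of \<open>d\<^sup>+\<close> exceeds the positive part of the image; since the image of \<open>d\<close> is
  \<open>d\<close>, the excess has total mass zero, so \<open>d\<^sup>+\<close> is itself invariant. An invariant nonnegative function
  is positive at every point reached from a point where it is positive.
\<close>

lemma positive_set_of_invariant_function_closed:
  fixes d :: "'s \<Rightarrow> real" and f :: "'m \<Rightarrow> 's \<Rightarrow> 's"
  assumes fin: "finite M" "finite S"
    and maps: "\<And>m s. m \<in> M \<Longrightarrow> s \<in> S \<Longrightarrow> f m s \<in> S"
    and inv: "\<And>s. s \<in> S \<Longrightarrow> card M * d s = (\<Sum>m\<in>M. \<Sum>r\<in>S. of_bool (f m r = s) * d r)"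
    and "m \<in> M" "s \<in> S" "d s > 0"
  shows "d (f m s) > 0"
proof -
  define e where "e s = max 0 (d s)" for s
  define R where "R s = (\<Sum>m\<in>M. \<Sum>r\<in>S. of_bool (f m r = s) * e r)" for s
  have le: "card M * e s \<le> R s" if "s \<in> S" for s
  proof (cases "d s > 0")
    case True
    then have "card M * e s = (\<Sum>m\<in>M. \<Sum>r\<in>S. of_bool (f m r = s) * d r)"
      using inv[OF that] by (simp add: e_def)
    also have "\<dots> \<le> R s"
      unfolding R_def by (intro sum_mono mult_left_mono) (auto simp: e_def)
    finally show ?thesis .
  next
    case False
    then show ?thesis by (auto simp: e_def R_def intro!: sum_nonneg)
  qed
  \<comment> \<open>Comparing total masses turns the pointwise inequality \<open>le\<close> into an equality.\<close>
  have "(\<Sum>s\<in>S. R s) = (\<Sum>m\<in>M. \<Sum>r\<in>S. \<Sum>s\<in>S. of_bool (f m r = s) * e r)"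
    unfolding R_def by (subst sum.swap, rule sum.cong[OF refl], subst sum.swap) simp
  also have "\<dots> = (\<Sum>m\<in>M. \<Sum>r\<in>S. e r)"
  proof (intro sum.cong refl)
    fix m r assume "m \<in> M" "r \<in> S"
    then have "f m r \<in> S" by (rule maps)
    have "(\<Sum>s\<in>S. of_bool (f m r = s) * e r) = (\<Sum>s\<in>S. if f m r = s then e r else 0)"
      by (rule sum.cong) auto
    then show "(\<Sum>s\<in>S. of_bool (f m r = s) * e r) = e r"
      using \<open>f m r \<in> S\<close> fin(2) by simp
  qed
  finally have "(\<Sum>s\<in>S. card M * e s) = (\<Sum>s\<in>S. R s)"
    by (simp add: sum_distrib_left)
  then have eq: "card M * e s = R s" if "s \<in> S" for s
    using sum_mono_inv[of "\<lambda>s. card M * e s" S R] le that fin(2) by blast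
  have "0 < of_bool (f m s = f m s) * e s" using \<open>d s > 0\<close> by (simp add: e_def)
  also have "\<dots> \<le> (\<Sum>r\<in>S. of_bool (f m r = f m s) * e r)"
    using \<open>s \<in> S\<close> fin(2) by (intro member_le_sum) (auto simp: e_def)
  also have "\<dots> \<le> R (f m s)"
    unfolding R_def using \<open>m \<in> M\<close> fin(1)
    by (intro member_le_sum[where f = "\<lambda>m'. \<Sum>r\<in>S. of_bool (f m' r = f m s) * e r"])
      (auto simp: e_def intro!: sum_nonneg)
  also have "R (f m s) = card M * e (f m s)"
    using eq maps \<open>m \<in> M\<close> \<open>s \<in> S\<close> by simp
  finally show ?thesis by (auto simp: e_def zero_less_mult_iff max_def split: if_splits)
qed

text \<open>
  If two stationary laws differ, then one of them gives more mass to some point and less to some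
  other point. Follow the same synchronizing word from both points: the sign of the difference of
  the laws is kept along each path, but the paths end at the same point.
\<close>

lemma stationary_law_of_synchronizing_maps_unique:
  fixes f :: "'m \<Rightarrow> 's \<Rightarrow> 's"
  assumes fin: "finite M" "M \<noteq> {}" "finite S"
    and maps: "\<And>m s. m \<in> M \<Longrightarrow> s \<in> S \<Longrightarrow> f m s \<in> S"
    and P: "set_pmf P \<subseteq> S" "bind_pmf P (\<lambda>r. map_pmf (\<lambda>m. f m r) (pmf_of_set M)) = P"
    and Q: "set_pmf Q \<subseteq> S" "bind_pmf Q (\<lambda>r. map_pmf (\<lambda>m. f m r) (pmf_of_set M)) = Q"
    and sync: "set w \<subseteq> M" "\<And>r s. r \<in> S \<Longrightarrow> s \<in> S \<Longrightarrow> fold f w r = fold f w s"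
  shows "P = Q"
proof -
  define d where "d s = pmf P s - pmf Q s" for s
  have inv: "card M * d s = (\<Sum>m\<in>M. \<Sum>r\<in>S. of_bool (f m r = s) * d r)" for s
    using pmf_random_map_step[OF fin P(1), of f s] pmf_random_map_step[OF fin Q(1), of f s]
    by (simp add: d_def P(2) Q(2) right_diff_distrib sum_subtractf)
  have inv': "card M * - d s = (\<Sum>m\<in>M. \<Sum>r\<in>S. of_bool (f m r = s) * - d r)" for s
    using inv[of s] by (simp add: sum_negf)
  have pos: "fold f ms s \<in> S \<and> g (fold f ms s) > 0"
    if "set ms \<subseteq> M" "s \<in> S" "g s > 0"
      "\<And>s. card M * g s = (\<Sum>m\<in>M. \<Sum>r\<in>S. of_bool (f m r = s) * g r)"
    for ms s and g :: "'s \<Rightarrow> real"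
    using that
  proof (induction ms arbitrary: s)
    case (Cons m ms)
    then show ?case
      using positive_set_of_invariant_function_closed[of M S f g m s] fin maps by simp
  qed simp
  have no_sign_change: "\<not> (d r > 0 \<and> d s < 0)" if "r \<in> S" "s \<in> S" for r s
    using pos[of w r d] pos[of w s "\<lambda>s. - d s"] sync(2)[OF that] sync(1) inv inv' that by force
  have sum0: "(\<Sum>s\<in>S. d s) = 0"
    using sum_pmf_eq_1[OF fin(3) P(1)] sum_pmf_eq_1[OF fin(3) Q(1)]
    by (simp add: d_def sum_subtractf)
  have "d s = 0" if "s \<in> S" for s
  proof (cases "\<exists>r\<in>S. d r > 0")
    case True
    then have "\<forall>s\<in>S. d s \<ge> 0" using no_sign_change by force
    then show ?thesis using sum0 that sum_nonneg_eq_0_iff[OF fin(3)] by metis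
  next
    case False
    then have "\<forall>s\<in>S. - d s \<ge> 0" by force
    moreover have "(\<Sum>s\<in>S. - d s) = 0" using sum0 by (simp add: sum_negf)
    ultimately have "- d s = 0" using that sum_nonneg_eq_0_iff[OF fin(3), of "\<lambda>s. - d s"] by auto
    then show ?thesis by simp
  qed
  moreover have "d s = 0" if "s \<notin> S" for s
  proof -
    have "s \<notin> set_pmf P" "s \<notin> set_pmf Q" using that P(1) Q(1) by auto
    then show ?thesis by (simp add: d_def set_pmf_iff)
  qed
  ultimately show ?thesis by (intro pmf_eqI) (metis d_def eq_iff_diff_eq_0)
qed

section \<open>Histories of last arrows\<close>

text \<open>
  The head is the most recent arrow. The vertex set \<open>A\<close> is a parameter separate from the set
  \<open>{1..n}\<close> of possible sources, because the tail of a history is again a history, on one vertex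
  fewer, whose arrows may still come from anywhere.
\<close>

definition histories :: "nat \<Rightarrow> nat set \<Rightarrow> (nat \<times> nat) list set" where
  "histories n A = {l. distinct (map snd l) \<and> snd ` set l = A \<and> set l \<subseteq> distinct_pairs n}"

definition record_arrow :: "nat \<times> nat \<Rightarrow> (nat \<times> nat) list \<Rightarrow> (nat \<times> nat) list" where
  "record_arrow p l = p # filter (\<lambda>q. snd q \<noteq> snd p) l"

text \<open>
  An arrow is an edge of the graph exactly if its source has an older last arrow; otherwise the edge
  was removed when the source was redrawn.
\<close>

fun history_graph :: "(nat \<times> nat) list \<Rightarrow> (nat \<times> nat) set" where
  "history_graph [] = {}"
| "history_graph (p # l) =
    (if fst p \<in> snd ` set l then insert p (history_graph l) else history_graph l)"

lemma finite_distinct_pairs: "finite (distinct_pairs n)"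
  by (rule finite_subset[of _ "{1..n} \<times> {1..n}"]) (auto simp: distinct_pairs_def)

lemma distinct_pairs_nonempty:
  assumes "n \<ge> 2"
  shows "distinct_pairs n \<noteq> {}"
proof -
  have "(1, 2) \<in> distinct_pairs n" using assms by (simp add: distinct_pairs_def)
  then show ?thesis by blast
qed

lemma finite_histories: "finite (histories n A)"
proof (rule finite_subset)
  show "histories n A \<subseteq> {l. set l \<subseteq> distinct_pairs n \<and> length l = card A}"
    unfolding histories_def by (auto dest!: distinct_card)
  show "finite {l. set l \<subseteq> distinct_pairs n \<and> length l = card A}"
    by (rule finite_lists_length_eq[OF finite_distinct_pairs])
qed

lemma histories_nonempty:
  assumes "n \<ge> 2"
  shows "histories n {1..n} \<noteq> {}"
proof -
  \<comment> \<open>The vertices in increasing order, with source 1, or 2 for the vertex 1 itself.\<close>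
  define l where "l = map (\<lambda>v. (if v = 1 then 2 else 1 :: nat, v)) [1..<Suc n]"
  have snd_l: "map snd l = [1..<Suc n]"
    by (simp add: l_def o_def del: upt_Suc)
  then have "snd ` set l = set [1..<Suc n]" by (metis set_map)
  then have "snd ` set l = {1..n}" by auto
  moreover have "set l \<subseteq> distinct_pairs n"
    using assms by (auto simp: l_def distinct_pairs_def split: if_splits)
  ultimately have "l \<in> histories n {1..n}"
    by (simp add: histories_def snd_l del: upt_Suc)
  then show ?thesis by blast
qed

lemma histories_empty: "histories n {} = {[]}"
  by (auto simp: histories_def)

lemma sum_histories_split_head:
  assumes "A \<noteq> {}" "A \<subseteq> {1..n}"
  shows "(\<Sum>l\<in>histories n A. h l) =
    (\<Sum>v\<in>A. \<Sum>u\<in>{1..n} - {v}. \<Sum>l\<in>histories n (A - {v}). h ((u, v) # l))"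
proof -
  let ?T = "SIGMA v:A. ({1..n} - {v}) \<times> histories n (A - {v})"
  let ?cons = "\<lambda>(v, u, l). (u, v) # l"
  have fin: "finite A" using assms(2) finite_subset by blast
  have "histories n A \<subseteq> ?cons ` ?T"
  proof
    fix l assume l: "l \<in> histories n A"
    with assms(1) obtain u v l' where [simp]: "l = (u, v) # l'"
      by (cases l) (auto simp: histories_def)
    have "(v, u, l') \<in> ?T"
      using l by (auto simp: histories_def distinct_pairs_def)
    then show "l \<in> ?cons ` ?T" by force
  qed
  moreover have "?cons ` ?T \<subseteq> histories n A"
  proof
    fix x assume "x \<in> ?cons ` ?T"
    then obtain u v l where x: "x = (u, v) # l" "v \<in> A" "u \<in> {1..n} - {v}"
      "l \<in> histories n (A - {v})" by (elim imageE SigmaE) auto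
    then have "(u, v) \<in> distinct_pairs n" using assms(2) by (auto simp: distinct_pairs_def)
    moreover have "insert v (A - {v}) = A" using x(2) by blast
    moreover have "v \<notin> snd ` set l" using x(4) by (simp add: histories_def)
    ultimately show "x \<in> histories n A" using x(1,4) by (simp add: histories_def)
  qed
  ultimately have "histories n A = ?cons ` ?T" by blast
  moreover have "inj_on ?cons ?T" by (auto simp: inj_on_def)
  ultimately have "(\<Sum>l\<in>histories n A. h l) = (\<Sum>x\<in>?T. h (?cons x))"
    by (simp add: sum.reindex)
  also have "\<dots> = (\<Sum>v\<in>A. \<Sum>(u, l)\<in>({1..n} - {v}) \<times> histories n (A - {v}). h ((u, v) # l))"
    using fin by (subst sum.Sigma) (auto simp: finite_histories intro!: sum.cong)
  finally show ?thesis by (simp add: sum.cartesian_product)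
qed

lemma history_graph_filter:
  "history_graph (filter (\<lambda>q. snd q \<noteq> v) l) = {(a, b) \<in> history_graph l. a \<noteq> v \<and> b \<noteq> v}"
  by (induction l) (auto simp: image_iff)

text \<open>
  The membership hypothesis holds for every drawn pair and every history on all of \<open>{1..n}\<close>. As the
  new arrow is the most recent one, its source is then older, so its edge is present.
\<close>

lemma history_graph_record_arrow:
  assumes "fst p \<in> snd ` set l" "fst p \<noteq> snd p"
  shows "history_graph (record_arrow p l) = moran_update p (history_graph l)"
proof -
  have "fst p \<in> snd ` set (filter (\<lambda>q. snd q \<noteq> snd p) l)"
    using assms by auto
  then show ?thesis
    by (simp add: record_arrow_def moran_update_def history_graph_filter case_prod_beta)
qed

text \<open>
  A history on \<open>A - {v}\<close> arises from a history on \<open>A\<close> by forgetting \<open>v\<close> in \<open>card A * (n - 1)\<close> ways: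
  one for each position of \<open>v\<close> and each source of its arrow. The induction splits off the head,
  which is either the arrow into \<open>v\<close> or an arrow that survives the forgetting.
\<close>

lemma sum_histories_remove_vertex:
  fixes h :: "_ \<Rightarrow> 'a :: comm_semiring_1"
  assumes "v \<in> A" "A \<subseteq> {1..n}"
  shows "(\<Sum>l\<in>histories n A. h (filter (\<lambda>q. snd q \<noteq> v) l)) =
    of_nat (card A * (n - 1)) * (\<Sum>l\<in>histories n (A - {v}). h l)"
  using assms
proof (induction "card A" arbitrary: A h rule: less_induct)
  case less
  have fin: "finite A" using less.prems(2) finite_subset by blast
  have card_sub: "card ({1..n} - {w}) = n - 1" if "w \<in> A" for w
    using that less.prems(2) by (auto simp: subset_iff)
  let ?F = "filter (\<lambda>q. snd q \<noteq> v)"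
  let ?rest = "\<Sum>l\<in>histories n (A - {v}). h l"
  have head_v: "(\<Sum>u\<in>{1..n} - {v}. \<Sum>l\<in>histories n (A - {v}). h (?F ((u, v) # l))) =
    of_nat (n - 1) * ?rest"
  proof -
    have "?F l = l" if "l \<in> histories n (A - {v})" for l
      using that by (auto simp: histories_def filter_id_conv)
    then have "(\<Sum>u\<in>{1..n} - {v}. \<Sum>l\<in>histories n (A - {v}). h (?F ((u, v) # l))) =
      (\<Sum>u\<in>{1..n} - {v}. ?rest)" by simp
    then show ?thesis using card_sub[OF less.prems(1)] by simp
  qed
  have head_w: "(\<Sum>w\<in>A - {v}. \<Sum>u\<in>{1..n} - {w}. \<Sum>l\<in>histories n (A - {w}). h (?F ((u, w) # l))) =
    of_nat ((card A - 1) * (n - 1)) * ?rest"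
  proof (cases "A - {v} = {}")
    case True
    then have "A = {v}" using less.prems(1) by blast
    then show ?thesis by simp
  next
    case False
    have "(\<Sum>l\<in>histories n (A - {w}). h (?F ((u, w) # l))) =
      of_nat ((card A - 1) * (n - 1)) * (\<Sum>l\<in>histories n (A - {v} - {w}). h ((u, w) # l))"
      if "w \<in> A - {v}" for u w
    proof -
      have smaller: "card (A - {w}) < card A"
        using that fin by (intro psubset_card_mono) auto
      have v: "v \<in> A - {w}" and sub: "A - {w} \<subseteq> {1..n}"
        using that less.prems by auto
      have F: "?F ((u, w) # l) = (u, w) # ?F l" for l
        using that by simp
      have "A - {w} - {v} = A - {v} - {w}" by blast
      moreover have "card (A - {w}) = card A - 1" using that fin by simp
      ultimately show ?thesis
        unfolding F using less.hyps[OF smaller v sub, of "\<lambda>l. h ((u, w) # l)"] by simp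
    qed
    then have "(\<Sum>w\<in>A - {v}. \<Sum>u\<in>{1..n} - {w}. \<Sum>l\<in>histories n (A - {w}). h (?F ((u, w) # l))) =
      (\<Sum>w\<in>A - {v}. \<Sum>u\<in>{1..n} - {w}. of_nat ((card A - 1) * (n - 1)) *
        (\<Sum>l\<in>histories n (A - {v} - {w}). h ((u, w) # l)))"
      by simp
    also have "\<dots> = of_nat ((card A - 1) * (n - 1)) * ?rest"
      using False less.prems(2)
      by (subst sum_histories_split_head) (auto simp: sum_distrib_left)
    finally show ?thesis .
  qed
  have "card A > 0" using less.prems(1) fin card_gt_0_iff by blast
  then have "card A * (n - 1) = (n - 1) + (card A - 1) * (n - 1)"
    by (cases "card A") simp_all
  moreover have "(\<Sum>l\<in>histories n A. h (?F l)) =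
    of_nat (n - 1) * ?rest + of_nat ((card A - 1) * (n - 1)) * ?rest"
  proof -
    have "A \<noteq> {}" using less.prems(1) by blast
    from sum_histories_split_head[OF this less.prems(2), of "\<lambda>l. h (?F l)"]
    show ?thesis
      unfolding sum.remove[OF fin less.prems(1)] head_v head_w .
  qed
  ultimately show ?case by (simp add: distrib_right)
qed

section \<open>The stationary law of the Moran chain\<close>

text \<open>
  This is double stochasticity of the chain of histories. The head of a history is the pair drawn in
  the last step, and its tail is the previous history with the drawn vertex forgotten. Hence every
  history has \<open>n * (n - 1)\<close> predecessors, as many as there are pairs to draw.
\<close>

lemma sum_record_arrow:
  fixes g :: "_ \<Rightarrow> 'a :: comm_semiring_1"
  assumes "n \<ge> 2"
  shows "(\<Sum>l\<in>histories n {1..n}. \<Sum>p\<in>distinct_pairs n. g (record_arrow p l)) =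
    of_nat (card (distinct_pairs n)) * (\<Sum>l\<in>histories n {1..n}. g l)"
proof -
  have pairs: "(\<Sum>p\<in>distinct_pairs n. k p) = (\<Sum>v\<in>{1..n}. \<Sum>u\<in>{1..n} - {v}. k (u, v))"
    for k :: "_ \<Rightarrow> 'b :: comm_monoid_add"
  proof -
    have "distinct_pairs n = prod.swap ` (SIGMA v:{1..n}. {1..n} - {v})"
      by (auto simp: distinct_pairs_def image_iff)
    then have "(\<Sum>p\<in>distinct_pairs n. k p) =
      (\<Sum>x\<in>(SIGMA v:{1..n}. {1..n} - {v}). k (prod.swap x))"
      by (simp add: sum.reindex)
    then show ?thesis by (simp add: sum.Sigma case_prod_beta prod.swap_def)
  qed
  have card: "card (distinct_pairs n) = n * (n - 1)"
    using pairs[of "\<lambda>_. 1::nat"] by simp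
  have "(\<Sum>l\<in>histories n {1..n}. \<Sum>p\<in>distinct_pairs n. g (record_arrow p l)) =
    (\<Sum>v\<in>{1..n}. \<Sum>u\<in>{1..n} - {v}. \<Sum>l\<in>histories n {1..n}.
      g ((u, v) # filter (\<lambda>q. snd q \<noteq> v) l))"
    by (subst sum.swap) (simp add: pairs record_arrow_def)
  also have "\<dots> = (\<Sum>v\<in>{1..n}. \<Sum>u\<in>{1..n} - {v}. of_nat (n * (n - 1)) *
      (\<Sum>l\<in>histories n ({1..n} - {v}). g ((u, v) # l)))"
    by (intro sum.cong refl, subst sum_histories_remove_vertex) auto
  also have "\<dots> = of_nat (n * (n - 1)) * (\<Sum>l\<in>histories n {1..n}. g l)"
    using assms by (subst (2) sum_histories_split_head) (auto simp: sum_distrib_left)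
  finally show ?thesis by (simp add: card)
qed

lemma moran_update_Un:
  "moran_update p (E \<union> F) = moran_update p E \<union> {(a, b) \<in> F. a \<noteq> snd p \<and> b \<noteq> snd p}"
  by (cases p) (auto simp: moran_update_def)

text \<open>
  An edge of the initial graph survives until one of its ends is drawn as a second component. A word
  that enters every vertex therefore forgets the initial graph.
\<close>

lemma fold_moran_update:
  "fold moran_update w E =
    fold moran_update w {} \<union> {(a, b) \<in> E. a \<notin> snd ` set w \<and> b \<notin> snd ` set w}"
proof (induction w rule: rev_induct)
  case (snoc p w)
  show ?case by (simp add: snoc.IH moran_update_Un) blast
qed simp

lemma moran_stationary_unique:
  assumes "n \<ge> 2" "moran_stationary n P" "moran_stationary n Q"
  shows "P = Q"
proof -
  \<comment> \<open>Any history on \<open>{1..n}\<close>, read as a word of pairs, enters every vertex.\<close>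
  obtain w where "w \<in> histories n {1..n}"
    using histories_nonempty[OF assms(1)] by blast
  then have w: "snd ` set w = {1..n}" "set w \<subseteq> distinct_pairs n"
    by (auto simp: histories_def)
  have forget: "fold moran_update w E = fold moran_update w {}" if "E \<in> digraphs n" for E
  proof -
    have "{(a, b) \<in> E. a \<notin> snd ` set w \<and> b \<notin> snd ` set w} = {}"
      using that by (auto simp: w(1) digraphs_def distinct_pairs_def)
    then show ?thesis by (subst fold_moran_update) blast
  qed
  show ?thesis
  proof (rule stationary_law_of_synchronizing_maps_unique[where f = moran_update
        and M = "distinct_pairs n" and S = "digraphs n" and w = w])
    show "distinct_pairs n \<noteq> {}" by (rule distinct_pairs_nonempty[OF assms(1)])
    show "moran_update p E \<in> digraphs n" if "p \<in> distinct_pairs n" "E \<in> digraphs n" for p E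
      using that by (cases p) (auto simp: moran_update_def digraphs_def)
    show "fold moran_update w E = fold moran_update w F"
      if "E \<in> digraphs n" "F \<in> digraphs n" for E F
      using forget that by metis
  qed (use assms w(2) in \<open>auto simp: finite_distinct_pairs digraphs_def moran_stationary_def
      moran_kernel_def[abs_def]\<close>)
qed

lemma history_chain_uniform_stationary:
  assumes "n \<ge> 2"
  shows "bind_pmf (pmf_of_set (histories n {1..n}))
    (\<lambda>l. map_pmf (\<lambda>p. record_arrow p l) (pmf_of_set (distinct_pairs n))) =
    pmf_of_set (histories n {1..n})" (is "bind_pmf ?U ?K = ?U")
proof (rule pmf_eqI)
  fix s
  let ?H = "histories n {1..n}" and ?M = "distinct_pairs n"
  have H: "finite ?H" "?H \<noteq> {}" using histories_nonempty[OF assms] by (simp_all add: finite_histories)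
  have M: "finite ?M" "?M \<noteq> {}"
    by (auto simp: finite_distinct_pairs distinct_pairs_nonempty[OF assms])
  have "pmf (bind_pmf ?U ?K) s = (\<Sum>l\<in>?H. (\<Sum>p\<in>?M. of_bool (record_arrow p l = s)) / card ?M) / card ?H"
    using H M by (simp add: pmf_bind pmf_map_pmf_of_set integral_pmf_of_set sum_divide_distrib[symmetric])
  also have "\<dots> = (\<Sum>l\<in>?H. of_bool (l = s)) / card ?H"
    using sum_record_arrow[OF assms, of "\<lambda>l. of_bool (l = s) :: real"] M
    by (simp add: sum_divide_distrib[symmetric])
  also have "\<dots> = pmf ?U s"
    using H by (simp add: indicator_def of_bool_def)
  finally show "pmf (bind_pmf ?U ?K) s = pmf ?U s" .
qed

lemma moran_forest_eq:
  assumes "n \<ge> 2"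
  shows "moran_forest n = map_pmf history_graph (pmf_of_set (histories n {1..n}))"
    (is "_ = map_pmf _ ?U")
proof -
  have U: "set_pmf ?U = histories n {1..n}"
    by (intro set_pmf_of_set finite_histories histories_nonempty assms)
  have M: "set_pmf (pmf_of_set (distinct_pairs n)) = distinct_pairs n"
    by (intro set_pmf_of_set finite_distinct_pairs distinct_pairs_nonempty[OF assms])
  have sub: "history_graph l \<subseteq> set l" for l by (induction l) auto
  have step: "moran_update p (history_graph l) = history_graph (record_arrow p l)"
    if "l \<in> histories n {1..n}" "p \<in> distinct_pairs n" for l p
  proof -
    have "snd ` set l = {1..n}" using that(1) by (simp add: histories_def)
    then show ?thesis
      using that(2) by (intro history_graph_record_arrow[symmetric]) (auto simp: distinct_pairs_def)
  qed
  have "bind_pmf (map_pmf history_graph ?U) (moran_kernel n) =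
    bind_pmf ?U (\<lambda>l. map_pmf (\<lambda>p. moran_update p (history_graph l)) (pmf_of_set (distinct_pairs n)))"
    by (simp add: bind_map_pmf moran_kernel_def)
  also have "\<dots> = bind_pmf ?U
    (\<lambda>l. map_pmf (\<lambda>p. history_graph (record_arrow p l)) (pmf_of_set (distinct_pairs n)))"
    by (intro bind_pmf_cong map_pmf_cong refl step) (simp_all only: U M)
  also have "\<dots> = map_pmf history_graph (bind_pmf ?U
    (\<lambda>l. map_pmf (\<lambda>p. record_arrow p l) (pmf_of_set (distinct_pairs n))))"
    by (simp add: map_bind_pmf pmf.map_comp o_def)
  finally have "bind_pmf (map_pmf history_graph ?U) (moran_kernel n) = map_pmf history_graph ?U"
    unfolding history_chain_uniform_stationary[OF assms] .
  moreover have "set_pmf (map_pmf history_graph ?U) \<subseteq> digraphs n"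
    unfolding set_map_pmf U using sub by (fastforce simp: histories_def digraphs_def)
  ultimately have st: "moran_stationary n (map_pmf history_graph ?U)"
    by (simp add: moran_stationary_def)
  then show ?thesis
    unfolding moran_forest_def using moran_stationary_unique[OF assms] by (intro the_equality)
qed

section \<open>Counting trees\<close>

text \<open>
  The root of a vertex is found by following edges back to older vertices. It labels the trees: two
  vertices are connected exactly if their roots agree.
\<close>

fun history_root :: "(nat \<times> nat) list \<Rightarrow> nat \<Rightarrow> nat" where
  "history_root [] x = x"
| "history_root (p # l) x =
    (if x = snd p \<and> fst p \<in> snd ` set l then history_root l (fst p) else history_root l x)"

text \<open>
  An arrow that is not an edge points at the root of a tree, and every tree has exactly one such root.
\<close>

fun history_trees :: "(nat \<times> nat) list \<Rightarrow> nat" where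
  "history_trees [] = 0"
| "history_trees (p # l) = history_trees l + (if fst p \<in> snd ` set l then 0 else 1)"

lemma history_graph_subset: "history_graph l \<subseteq> snd ` set l \<times> snd ` set l"
  by (induction l) (force split: if_splits)+

lemma history_root_outside: "x \<notin> snd ` set l \<Longrightarrow> history_root l x = x"
  by (induction l) auto

lemma history_root_mem: "x \<in> snd ` set l \<Longrightarrow> history_root l x \<in> snd ` set l"
proof (induction l arbitrary: x)
  case (Cons p l)
  then show ?case
    by (cases "x \<in> snd ` set l") (auto simp: history_root_outside)
qed simp

lemma history_root_edge:
  assumes "distinct (map snd l)" "(a, b) \<in> history_graph l"
  shows "history_root l a = history_root l b"
  using assms
proof (induction l)
  case (Cons p l)
  have old: "a \<noteq> snd p \<and> b \<noteq> snd p" if "(a, b) \<in> history_graph l"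
    using that history_graph_subset[of l] Cons.prems(1) by auto
  show ?case
  proof (cases "(a, b) \<in> history_graph l")
    case True
    then show ?thesis using Cons old by auto
  next
    case False
    then have "p = (a, b)" "a \<in> snd ` set l" 
      using Cons.prems(2) by (auto split: if_splits intro: rev_image_eqI)
    then show ?thesis by simp
  qed
qed simp

lemma history_root_connected:
  "(x, history_root l x) \<in> (history_graph l \<union> (history_graph l)\<inverse>)\<^sup>*"
proof (induction l arbitrary: x)
  case (Cons p l)
  let ?C = "\<lambda>l. (history_graph l \<union> (history_graph l)\<inverse>)\<^sup>*"
  have mono: "?C l \<subseteq> ?C (p # l)" by (rule rtrancl_mono) auto
  show ?case
  proof (cases "x = snd p \<and> fst p \<in> snd ` set l")
    case True
    then have "(x, fst p) \<in> ?C (p # l)" by (intro r_into_rtrancl) auto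
    also have "(fst p, history_root l (fst p)) \<in> ?C (p # l)" using Cons mono by blast
    finally show ?thesis using True by simp
  next
    case False
    then show ?thesis using Cons mono by (simp del: history_graph.simps) blast
  qed
qed simp

text \<open>
  From the oldest arrow on, a vertex that gets an edge takes over an existing root, and any other
  vertex becomes a root itself.
\<close>

lemma card_history_roots:
  assumes "distinct (map snd l)"
  shows "card (history_root l ` snd ` set l) = history_trees l"
  using assms
proof (induction l)
  case (Cons p l)
  let ?A = "snd ` set l"
  have new: "snd p \<notin> ?A" using Cons.prems by simp
  then have old: "history_root (p # l) ` ?A = history_root l ` ?A"
    by (intro image_cong refl) (simp, blast)
  show ?case
  proof (cases "fst p \<in> ?A")
    case True
    have "history_root (p # l) ` snd ` set (p # l) =
      insert (history_root (p # l) (snd p)) (history_root (p # l) ` ?A)"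
      by (simp only: list.set image_insert)
    also have "\<dots> = insert (history_root l (fst p)) (history_root l ` ?A)"
      unfolding old using True by simp
    also have "\<dots> = history_root l ` ?A" using True by blast
    finally have "history_root (p # l) ` snd ` set (p # l) = history_root l ` ?A" .
    then show ?thesis using Cons True by simp
  next
    case False
    have "history_root (p # l) ` snd ` set (p # l) = insert (snd p) (history_root l ` ?A)"
      using False old history_root_outside[OF new] by simp
    moreover have "snd p \<notin> history_root l ` ?A"
    proof
      assume "snd p \<in> history_root l ` ?A"
      then obtain x where x: "snd p = history_root l x" "x \<in> ?A" by (rule imageE)
      show False using history_root_mem[OF x(2)] new unfolding x(1) by contradiction
    qed
    ultimately show ?thesis using Cons False by simp
  qed
qed simp

lemma card_quotient_kernel:
  assumes "\<And>x y. x \<in> A \<Longrightarrow> y \<in> A \<Longrightarrow> (x, y) \<in> R \<longleftrightarrow> f x = f y"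
  shows "card (A // Restr R A) = card (f ` A)"
proof -
  have "Restr R A `` {x} = {y \<in> A. f y = f x}" if "x \<in> A" for x
    using assms[OF that] that by auto
  then have "A // Restr R A = (\<lambda>c. {y \<in> A. f y = c}) ` f ` A"
    by (auto simp: quotient_def)
  moreover have "inj_on (\<lambda>c. {y \<in> A. f y = c}) (f ` A)"
    by (auto simp: inj_on_def)
  ultimately show ?thesis by (simp add: card_image)
qed

lemma num_trees_history_graph:
  assumes "l \<in> histories n {1..n}"
  shows "num_trees n (history_graph l) = history_trees l"
proof -
  have l: "distinct (map snd l)" "snd ` set l = {1..n}"
    using assms by (auto simp: histories_def)
  let ?C = "(history_graph l \<union> (history_graph l)\<inverse>)\<^sup>*"
  have sym: "sym ?C" by (intro sym_rtrancl) (auto simp: sym_def)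
  have "(x, y) \<in> ?C \<longleftrightarrow> history_root l x = history_root l y" for x y
  proof
    assume "(x, y) \<in> ?C"
    then show "history_root l x = history_root l y"
      by (induction rule: rtrancl_induct) (use history_root_edge[OF l(1)] in auto)
  next
    assume "history_root l x = history_root l y"
    then show "(x, y) \<in> ?C"
      using history_root_connected[of x l] history_root_connected[of y l] sym
      by (metis rtrancl_trans symD)
  qed
  then show ?thesis
    using card_history_roots[OF l(1)] l(2)
    by (simp add: num_trees_def trees_def card_quotient_kernel[where f = "history_root l"])
qed

section \<open>The generating function\<close>

text \<open>
  The most recent of \<open>k\<close> vertices can be chosen in \<open>k\<close> ways. Of its \<open>n - 1\<close> possible sources, \<open>k - 1\<close>
  are older vertices of the history and leave the number of trees unchanged, and \<open>n - k\<close> are not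
  and add a tree.
\<close>

lemma sum_power_history_trees:
  fixes z :: "'a :: comm_semiring_1"
  assumes "A \<subseteq> {1..n}"
  shows "(\<Sum>l\<in>histories n A. z ^ history_trees l) =
    (\<Prod>k = 1..card A. of_nat k * (of_nat (k - 1) + of_nat (n - k) * z))"
  using assms
proof (induction "card A" arbitrary: A)
  case 0
  then have "A = {}" using finite_subset by fastforce
  then show ?case by (simp add: histories_empty)
next
  case (Suc k)
  have fin: "finite A" using Suc.prems finite_subset by blast
  let ?W = "\<Prod>j = 1..k. of_nat j * (of_nat (j - 1) + of_nat (n - j) * z)"
  have "(\<Sum>u\<in>{1..n} - {v}. \<Sum>l\<in>histories n (A - {v}). z ^ history_trees ((u, v) # l)) =
    (of_nat k + of_nat (n - Suc k) * z) * ?W" if v: "v \<in> A" for v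
  proof -
    have card: "card (A - {v}) = k" using v Suc.hyps(2) by simp
    have W: "(\<Sum>l\<in>histories n (A - {v}). z ^ history_trees l) = ?W"
      using Suc.hyps(1)[of "A - {v}"] card Suc.prems by auto
    have "(\<Sum>l\<in>histories n (A - {v}). z ^ history_trees ((u, v) # l)) =
      (if u \<in> A - {v} then ?W else z * ?W)" for u
    proof -
      have "z ^ history_trees ((u, v) # l) =
        (if u \<in> A - {v} then 1 else z) * z ^ history_trees l" if "l \<in> histories n (A - {v})" for l
        using that by (auto simp: histories_def)
      then have "(\<Sum>l\<in>histories n (A - {v}). z ^ history_trees ((u, v) # l)) =
        (if u \<in> A - {v} then 1 else z) * (\<Sum>l\<in>histories n (A - {v}). z ^ history_trees l)"
        by (simp add: sum_distrib_left)
      then show ?thesis by (simp add: W)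
    qed
    then have "(\<Sum>u\<in>{1..n} - {v}. \<Sum>l\<in>histories n (A - {v}). z ^ history_trees ((u, v) # l)) =
      (\<Sum>u\<in>{1..n} - {v}. if u \<in> A - {v} then ?W else z * ?W)"
      by simp
    also have "\<dots> = (\<Sum>u\<in>A - {v}. ?W) + (\<Sum>u\<in>{1..n} - A. z * ?W)"
    proof -
      have split: "{1..n} - {v} = (A - {v}) \<union> ({1..n} - A)"
        using Suc.prems v by auto
      have disj: "(A - {v}) \<inter> ({1..n} - A) = {}" by blast
      show ?thesis
        unfolding split sum.union_disjoint[OF finite_Diff[OF fin] finite_Diff[OF finite_atLeastAtMost] disj]
        by (intro arg_cong2[where f = "(+)"] sum.cong refl) simp_all
    qed
    also have "\<dots> = of_nat k * ?W + of_nat (n - Suc k) * (z * ?W)"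
      using card Suc.hyps(2) Suc.prems fin by (simp add: card_Diff_subset)
    finally show ?thesis by (simp add: algebra_simps)
  qed
  moreover have "A \<noteq> {}" using Suc.hyps(2) by auto
  ultimately have "(\<Sum>l\<in>histories n A. z ^ history_trees l) =
    (\<Sum>v\<in>A. (of_nat k + of_nat (n - Suc k) * z) * ?W)"
    using Suc.prems by (subst sum_histories_split_head) auto
  then show ?case by (simp add: Suc.hyps(2)[symmetric] algebra_simps)
qed

lemma card_histories:
  assumes "n \<ge> 1"
  shows "card (histories n {1..n}) = fact n * (n - 1) ^ n"
proof -
  have "card (histories n {1..n}) = (\<Prod>k = 1..n. k * ((k - 1) + (n - k)))"
    using sum_power_history_trees[of "{1..n}" n "1::nat"] by simp
  also have "\<dots> = (\<Prod>k = 1..n. k * (n - 1))" by (intro prod.cong) auto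
  finally show ?thesis by (simp add: prod.distrib fact_prod)
qed

lemma average_power_history_trees:
  fixes z :: "'a :: field_char_0"
  assumes "n \<ge> 2"
  shows "(\<Sum>l\<in>histories n {1..n}. z ^ history_trees l) / of_nat (card (histories n {1..n})) =
    (\<Prod>k = 1..n - 1. 1 + of_nat k / of_nat (n - 1) * (z - 1))"
proof -
  let ?c = "of_nat (n - 1) :: 'a"
  have c: "?c \<noteq> 0" using assms by simp
  have total: "of_nat (card (histories n {1..n})) = (\<Prod>k = 1..n. of_nat k * ?c)"
    using assms by (subst card_histories) (simp_all add: prod.distrib fact_prod)
  have "(\<Sum>l\<in>histories n {1..n}. z ^ history_trees l) / of_nat (card (histories n {1..n})) =
    (\<Prod>k = 1..n. of_nat k * (of_nat (k - 1) + of_nat (n - k) * z)) / (\<Prod>k = 1..n. of_nat k * ?c)"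
    using total sum_power_history_trees[of "{1..n}" n z] by simp
  also have "\<dots> = (\<Prod>k = 1..n. 1 + of_nat (n - k) / ?c * (z - 1))"
    unfolding prod_dividef[symmetric]
  proof (intro prod.cong refl)
    fix k assume k: "k \<in> {1..n}"
    then have "of_nat (k - 1) = ?c - of_nat (n - k)"
      by (simp add: of_nat_diff)
    then show "of_nat k * (of_nat (k - 1) + of_nat (n - k) * z) / (of_nat k * ?c) =
      1 + of_nat (n - k) / ?c * (z - 1)"
      using k c by (simp add: divide_simps) (simp add: algebra_simps)
  qed
  \<comment> \<open>The factor of the most recent vertex, which always joins a tree, is 1 and is dropped at the end.\<close>
  also have "\<dots> = (\<Prod>k = 0..n - 1. 1 + of_nat k / ?c * (z - 1))"
    by (rule prod.reindex_bij_witness[of _ "\<lambda>k. n - k" "\<lambda>k. n - k"]) (use assms in auto)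
  also have "\<dots> = (\<Prod>k = 1..n - 1. 1 + of_nat k / ?c * (z - 1))"
    by (simp add: prod.atLeast_Suc_atMost)
  finally show ?thesis .
qed

lemma moran_forest_pgf:
  fixes z :: "'a :: {real_normed_field, second_countable_topology, banach}"
  assumes "n \<ge> 2"
  shows "measure_pmf.expectation (moran_forest n) (\<lambda>F. z ^ num_trees n F) =
    (\<Prod>k = 1..n - 1. 1 + of_nat k / of_nat (n - 1) * (z - 1))"
proof -
  let ?H = "histories n {1..n}"
  have H: "finite ?H" "?H \<noteq> {}" using histories_nonempty[OF assms] by (simp_all add: finite_histories)
  have "measure_pmf.expectation (moran_forest n) (\<lambda>F. z ^ num_trees n F) =
    (\<Sum>l\<in>?H. pmf (pmf_of_set ?H) l *\<^sub>R z ^ num_trees n (history_graph l))"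
    using H
    by (subst moran_forest_eq[OF assms], subst integral_map_pmf, subst integral_measure_pmf[of ?H]) auto
  also have "\<dots> = (\<Sum>l\<in>?H. z ^ history_trees l) / of_nat (card ?H)"
    using H by (simp add: num_trees_history_graph scaleR_conv_of_real sum_divide_distrib)
  finally show ?thesis using average_power_history_trees[OF assms] by simp
qed

section \<open>Moments from a product generating function\<close>

lemma coeff_one_plus_X_power:
  "coeff ([:1, 1:] ^ m :: 'a :: idom poly) i = of_nat (m choose i)"
proof (cases "i \<le> m")
  case False
  then have "degree ([:1, 1:] ^ m :: 'a poly) < i" by (simp add: degree_power_eq)
  then show ?thesis using False by (simp add: coeff_eq_0 binomial_eq_0)
qed (simp add: coeff_linear_poly_power)

lemma coeff_prod_linear:
  fixes a :: "'k \<Rightarrow> 'a :: field_char_0"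
  assumes "finite K"
  shows "coeff (\<Prod>k\<in>K. [:1, a k:]) 1 = (\<Sum>k\<in>K. a k)"
    and "2 * coeff (\<Prod>k\<in>K. [:1, a k:]) 2 = (\<Sum>k\<in>K. a k)\<^sup>2 - (\<Sum>k\<in>K. (a k)\<^sup>2)"
proof -
  have "coeff (\<Prod>k\<in>K. [:1, a k:]) 0 = 1 \<and> coeff (\<Prod>k\<in>K. [:1, a k:]) 1 = (\<Sum>k\<in>K. a k) \<and>
    2 * coeff (\<Prod>k\<in>K. [:1, a k:]) 2 = (\<Sum>k\<in>K. a k)\<^sup>2 - (\<Sum>k\<in>K. (a k)\<^sup>2)"
    using assms
  proof (induction K rule: finite_induct)
    case (insert x K)
    then show ?case
      by (simp add: numeral_2_eq_2 coeff_pCons power2_eq_square algebra_simps)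
  qed simp
  then show "coeff (\<Prod>k\<in>K. [:1, a k:]) 1 = (\<Sum>k\<in>K. a k)"
    and "2 * coeff (\<Prod>k\<in>K. [:1, a k:]) 2 = (\<Sum>k\<in>K. a k)\<^sup>2 - (\<Sum>k\<in>K. (a k)\<^sup>2)"
    by blast+
qed

text \<open>
  Substituting \<open>z = 1 + y\<close> makes the generating function a polynomial in \<open>y\<close> whose \<open>i\<close>-th coefficient
  is the expectation of \<open>N choose i\<close>. On the product side the coefficients are the elementary
  symmetric functions of the \<open>a k\<close>, and the first two of them determine mean and variance.
\<close>

lemma moments_of_product_generating_function:
  fixes P :: "'s pmf" and N :: "'s \<Rightarrow> nat" and a :: "'k \<Rightarrow> real"
  assumes fin: "finite (set_pmf P)" "finite K"
    and pgf: "\<And>z. measure_pmf.expectation P (\<lambda>x. z ^ N x) = (\<Prod>k\<in>K. 1 + a k * (z - 1))"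
  shows "measure_pmf.expectation P (\<lambda>x. real (N x)) = (\<Sum>k\<in>K. a k)"
    and "measure_pmf.variance P (\<lambda>x. real (N x)) = (\<Sum>k\<in>K. a k * (1 - a k))"
proof -
  let ?E = "measure_pmf.expectation P"
  have expect: "?E g = (\<Sum>x\<in>set_pmf P. pmf P x * g x)" for g :: "'s \<Rightarrow> real"
    using integral_measure_pmf_real[OF fin(1), of P g] by (simp add: mult.commute)
  have poly_eq: "(\<Sum>x\<in>set_pmf P. smult (pmf P x) ([:1, 1:] ^ N x)) = (\<Prod>k\<in>K. [:1, a k:])"
  proof -
    have "(\<Sum>x\<in>set_pmf P. pmf P x * (1 + y) ^ N x) = (\<Prod>k\<in>K. 1 + y * a k)" for y
      using pgf[of "1 + y"] by (simp add: expect mult.commute)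
    then have "poly (\<Sum>x\<in>set_pmf P. smult (pmf P x) ([:1, 1:] ^ N x)) = poly (\<Prod>k\<in>K. [:1, a k:])"
      by (simp add: fun_eq_iff poly_sum poly_prod)
    then show ?thesis by (simp add: poly_eq_poly_eq_iff)
  qed
  have coeff: "(\<Sum>x\<in>set_pmf P. pmf P x * real (N x choose i)) = coeff (\<Prod>k\<in>K. [:1, a k:]) i" for i
    unfolding poly_eq[symmetric] by (simp add: coeff_sum coeff_one_plus_X_power)
  show mean: "?E (\<lambda>x. real (N x)) = (\<Sum>k\<in>K. a k)"
    using coeff[of 1] coeff_prod_linear(1)[OF fin(2), of a] by (simp add: expect)
  have choose2: "real (m * m) = 2 * real (m choose 2) + real m" for m
    by (induction m) (simp_all add: numeral_2_eq_2 algebra_simps)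
  have "?E (\<lambda>x. (real (N x))\<^sup>2) = 2 * (\<Sum>x\<in>set_pmf P. pmf P x * real (N x choose 2)) + ?E (\<lambda>x. real (N x))"
    using choose2 by (simp add: expect power2_eq_square sum_distrib_left sum.distrib[symmetric] algebra_simps)
  also have "\<dots> = (\<Sum>k\<in>K. a k)\<^sup>2 - (\<Sum>k\<in>K. (a k)\<^sup>2) + (\<Sum>k\<in>K. a k)"
    using coeff_prod_linear(2)[OF fin(2), of a] by (simp add: coeff mean)
  finally show "measure_pmf.variance P (\<lambda>x. real (N x)) = (\<Sum>k\<in>K. a k * (1 - a k))"
    using mean
    by (subst measure_pmf.variance_eq)
      (auto simp: integrable_measure_pmf_finite fin sum_subtractf right_diff_distrib power2_eq_square)
qed

theorem proposition3p1:
  fixes n :: nat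
  assumes "n \<ge> 2"
  shows "measure_pmf.expectation (moran_forest n) (\<lambda>F. real (num_trees n F)) = real n / 2 \<and>
    measure_pmf.variance (moran_forest n) (\<lambda>F. real (num_trees n F)) =
      real n * (real n - 2) / (6 * (real n - 1)) \<and>
    (\<forall>z :: complex. measure_pmf.expectation (moran_forest n) (\<lambda>F. z ^ num_trees n F) =
      (\<Prod>k = 1..n - 1. 1 + of_nat k / of_nat (n - 1) * (z - 1)))"
proof -
  have fin: "finite (set_pmf (moran_forest n))"
    using histories_nonempty[OF assms]
    by (simp add: moran_forest_eq[OF assms] finite_histories)
  note moments = moments_of_product_generating_function[OF fin finite_atLeastAtMost
      moran_forest_pgf[OF assms]]
  have sum1: "(\<Sum>k = 1..m. real k) = real m * (real m + 1) / 2" for m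
    by (induction m) (simp_all add: field_simps)
  have sum2: "(\<Sum>k = 1..m. real k * (c - real k)) = real m * (real m + 1) * (3 * c - 2 * real m - 1) / 6"
    for m c
    by (induction m) (simp_all add: field_simps)
  have c: "real (n - 1) = real n - 1" "real n - 1 \<noteq> 0" using assms by auto
  have "(\<Sum>k = 1..n - 1. real k / real (n - 1)) = (real (n - 1) + 1) / 2"
  proof -
    have "x * (x + 1) / 2 / x = (x + 1) / 2" if "x \<noteq> 0" for x :: real
      using that by simp
    then show ?thesis
      unfolding sum_divide_distrib[symmetric] sum1 using c by metis
  qed
  then have "(\<Sum>k = 1..n - 1. real k / real (n - 1)) = real n / 2"
    unfolding c(1) by simp
  moreover have "(\<Sum>k = 1..n - 1. real k / real (n - 1) * (1 - real k / real (n - 1))) =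
    real n * (real n - 2) / (6 * (real n - 1))"
  proof -
    have "(\<Sum>k = 1..n - 1. real k / real (n - 1) * (1 - real k / real (n - 1))) =
      (\<Sum>k = 1..n - 1. real k * (real (n - 1) - real k)) / (real (n - 1))\<^sup>2"
      unfolding sum_divide_distrib
      using c by (intro sum.cong) (auto simp: field_simps power2_eq_square)
    also have "\<dots> = real n * (real n - 2) / (6 * (real n - 1))"
      unfolding sum2 using c by (simp add: power2_eq_square divide_simps)
    finally show ?thesis .
  qed
  ultimately show ?thesis using moments moran_forest_pgf[OF assms, where 'a = complex] by simp
qed

end
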